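(* Let $X: I\to Q^2_+$ be a spacelike curve parametrized by arc length $s$ such that $k(s)\neq0$ for all $s\in I$. Then $X$ is a self-similar solution to the inverse curvature flow (ICF) on $Q^2_+$ if and only if there exist a vector $v\in\mathbb{R}^3_1\setminus\{0\}$ and $c\in\mathbb{R}$ such that $$c+\langle T(s),v\rangle=\frac1{k(s)}\quad\text{for all } s\in I,$$ where $T$ is the unit tangent vector field and $k$ is the curvature of $X$. In particular, $X$ is a soliton solution to the ICF whenever $c=0$.
   Context: $\mathbb{R}^3_1$ is $\mathbb{R}^3$ with the Minkowski metric $\langle u,v\rangle=-u_1v_1+u_2v_2+u_3v_3$. The light cone is $Q^2=\{p\in\mathbb{R}^3_1\setminus\{0\}:\langle p,p\rangle=0\}$ and $Q^2_+=\{p\in Q^2:p_1>0\}$. For a (smooth) spacelike curve $X$ on $Q^2$ parametrized by arc length $s$, $T=X'$ is the unit tangent field, $Y(s)$ is the unique lightlike vector orthogonal to $T(s)$ with $\langle X(s),Y(s)\rangle=1$ (the associated curve), and the curvature $k$ is defined by $T'=kX-Y$. For an arbitrary parameter, $T,Y,k$ are those obtained via arc-length reparametrization. A 1-parameter family of spacelike curves $\hat X:I\times J\to Q^2_+$, $J$ an interval containing $0$, with associated curves $\hat Y^t$ and non-vanishing curvatures $\hat k^t$, is a solution to the ICF with initial condition $X$ if $\langle \frac{\partial}{\partial t}\hat X^t,\hat Y^t\rangle=-1/\hat k^t$ and $\hat X^0=X$. An isometry of $Q^2_+$ is an element of the Lie group $O_1(3)$ (linear isometries of $\mathbb{R}^3_1$)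 preserving $Q^2_+$. The curve $X$ is a self-similar solution to the ICF if there is a solution to the ICF of the form $\hat X^t(s)=f(t)M(t)X(s)$, where $f(t)>0$ is smooth with $f(0)=1$ and $M(t)$, $t\in J$, is a smooth family of isometries of $Q^2_+$ with $M(0)=\mathrm{Id}$. If moreover $f\equiv1$, $X$ is a soliton solution. *)

theory Defs
  imports "HOL-Analysis.Analysis"
begin

subsection \<open>Minkowski space and the light cone\<close>

definition mink :: "real^3 \<Rightarrow> real^3 \<Rightarrow> real" where
  "mink u v = - (u$1 * v$1) + u$2 * v$2 + u$3 * v$3"

definition light_cone :: "(real^3) set" where
  "light_cone = {p. p \<noteq> 0 \<and> mink p p = 0}"

definition light_cone_plus :: "(real^3) set" where
  "light_cone_plus = {p \<in> light_cone. p$1 > 0}"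

definition lorentz_group :: "(real^3^3) set" where
  "lorentz_group = {A. \<forall>u v. mink (A *v u) (A *v v) = mink u v}"

definition cone_isometries :: "(real^3^3) set" where
  "cone_isometries = {A \<in> lorentz_group. (\<lambda>p. A *v p) ` light_cone_plus = light_cone_plus}"


subsection \<open>Smoothness\<close>

text \<open>
  All derivatives are taken within the domain, so that intervals containing some of their end
  points are covered (one-sided derivatives there). The domains below are nondegenerate intervals
  and products of two such, where derivatives within the domain are unique.
\<close>

primrec Ck_on :: "nat \<Rightarrow> 'a::real_normed_vector set \<Rightarrow> ('a \<Rightarrow> 'b::real_normed_vector) \<Rightarrow> bool" where
  "Ck_on 0 S f \<longleftrightarrow> continuous_on S f"
| "Ck_on (Suc k) S f \<longleftrightarrow>
     (\<exists>f'. (\<forall>x\<in>S. (f has_derivative f' x) (at x within S)) \<and> (\<forall>v. Ck_on k S (\<lambda>x. f' x v)))"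

definition smooth_on :: "'a::real_normed_vector set \<Rightarrow> ('a \<Rightarrow> 'b::real_normed_vector) \<Rightarrow> bool" where
  "smooth_on S f \<longleftrightarrow> (\<forall>k. Ck_on k S f)"

definition nondegenerate_interval :: "real set \<Rightarrow> bool" where
  "nondegenerate_interval I \<longleftrightarrow> is_interval I \<and> interior I \<noteq> {}"


subsection \<open>Spacelike curves on the light cone\<close>

definition velocity :: "real set \<Rightarrow> (real \<Rightarrow> real^3) \<Rightarrow> real \<Rightarrow> real^3" where
  "velocity I X s = vector_derivative X (at s within I)"

definition spacelike_curve :: "real set \<Rightarrow> (real \<Rightarrow> real^3) \<Rightarrow> bool" where
  "spacelike_curve I X \<longleftrightarrow>
     nondegenerate_interval I \<and> smooth_on I X \<and> X ` I \<subseteq> light_cone \<and>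
     (\<forall>s\<in>I. mink (velocity I X s) (velocity I X s) > 0)"

definition arc_length_curve :: "real set \<Rightarrow> (real \<Rightarrow> real^3) \<Rightarrow> bool" where
  "arc_length_curve I X \<longleftrightarrow>
     spacelike_curve I X \<and> (\<forall>s\<in>I. mink (velocity I X s) (velocity I X s) = 1)"

text \<open>The next three notions are for curves parametrized by arc length.\<close>

definition unit_tangent :: "real set \<Rightarrow> (real \<Rightarrow> real^3) \<Rightarrow> real \<Rightarrow> real^3" where
  "unit_tangent I X s = velocity I X s"

definition associated :: "real set \<Rightarrow> (real \<Rightarrow> real^3) \<Rightarrow> real \<Rightarrow> real^3" where
  "associated I X s =
     (THE y. y \<in> light_cone \<and> mink y (unit_tangent I X s) = 0 \<and> mink (X s) y = 1)"

definition curvature :: "real set \<Rightarrow> (real \<Rightarrow> real^3) \<Rightarrow> real \<Rightarrow> real" where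
  "curvature I X s =
     (THE \<kappa>. vector_derivative (unit_tangent I X) (at s within I) = \<kappa> *\<^sub>R X s - associated I X s)"

text \<open>
  For an arbitrary parameter, pass to the arc-length reparametrization. An arc length function
  is unique on \<open>I\<close> up to an additive constant, which affects neither the associated
  curve nor the curvature below; \<open>SOME\<close> picks one.
\<close>

definition arc_length :: "real set \<Rightarrow> (real \<Rightarrow> real^3) \<Rightarrow> real \<Rightarrow> real" where
  "arc_length I Z =
     (SOME l. \<forall>u\<in>I. (l has_real_derivative sqrt (mink (velocity I Z u) (velocity I Z u)))
                        (at u within I))"

definition arc_length_domain :: "real set \<Rightarrow> (real \<Rightarrow> real^3) \<Rightarrow> real set" where
  "arc_length_domain I Z = arc_length I Z ` I"

definition arc_length_reparam :: "real set \<Rightarrow> (real \<Rightarrow> real^3) \<Rightarrow> real \<Rightarrow> real^3" where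
  "arc_length_reparam I Z = Z \<circ> inv_into I (arc_length I Z)"

definition associated_gen :: "real set \<Rightarrow> (real \<Rightarrow> real^3) \<Rightarrow> real \<Rightarrow> real^3" where
  "associated_gen I Z u =
     associated (arc_length_domain I Z) (arc_length_reparam I Z) (arc_length I Z u)"

definition curvature_gen :: "real set \<Rightarrow> (real \<Rightarrow> real^3) \<Rightarrow> real \<Rightarrow> real" where
  "curvature_gen I Z u =
     curvature (arc_length_domain I Z) (arc_length_reparam I Z) (arc_length I Z u)"


subsection \<open>The inverse curvature flow\<close>

text \<open>A family is a function \<open>Xh\<close> of two arguments; \<open>Xh t s\<close> is the point with
  parameter \<open>s\<close> on the curve at time \<open>t\<close>.\<close>

definition icf_solution ::
  "real set \<Rightarrow> real set \<Rightarrow> (real \<Rightarrow> real \<Rightarrow> real^3) \<Rightarrow> (real \<Rightarrow> real^3) \<Rightarrow> bool" where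
  "icf_solution I J Xh X \<longleftrightarrow>
     nondegenerate_interval J \<and> 0 \<in> J \<and>
     smooth_on (I \<times> J) (\<lambda>(s, t). Xh t s) \<and>
     (\<forall>t\<in>J. spacelike_curve I (Xh t) \<and> Xh t ` I \<subseteq> light_cone_plus) \<and>
     (\<forall>t\<in>J. \<forall>s\<in>I. curvature_gen I (Xh t) s \<noteq> 0) \<and>
     (\<forall>t\<in>J. \<forall>s\<in>I.
        mink (vector_derivative (\<lambda>\<tau>. Xh \<tau> s) (at t within J)) (associated_gen I (Xh t) s)
          = - 1 / curvature_gen I (Xh t) s) \<and>
     (\<forall>s\<in>I. Xh 0 s = X s)"

definition self_similar_flow ::
  "real set \<Rightarrow> (real \<Rightarrow> real^3) \<Rightarrow> real set \<Rightarrow> (real \<Rightarrow> real) \<Rightarrow> (real \<Rightarrow> real^3^3) \<Rightarrow> bool" where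
  "self_similar_flow I X J f M \<longleftrightarrow>
     smooth_on J f \<and> (\<forall>t\<in>J. f t > 0) \<and> f 0 = 1 \<and>
     smooth_on J M \<and> (\<forall>t\<in>J. M t \<in> cone_isometries) \<and> M 0 = mat 1 \<and>
     icf_solution I J (\<lambda>t s. f t *\<^sub>R (M t *v X s)) X"

definition self_similar_solution :: "real set \<Rightarrow> (real \<Rightarrow> real^3) \<Rightarrow> bool" where
  "self_similar_solution I X \<longleftrightarrow> (\<exists>J f M. self_similar_flow I X J f M)"

definition soliton_solution :: "real set \<Rightarrow> (real \<Rightarrow> real^3) \<Rightarrow> bool" where
  "soliton_solution I X \<longleftrightarrow> (\<exists>J f M. self_similar_flow I X J f M \<and> (\<forall>t\<in>J. f t = 1))"

end

theory Submission
  imports Defs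
begin

text \<open>
  A homothety \<open>a A\<close> with \<open>A\<close> in \<open>O\<^sub>1(3)\<close> sends the frame \<open>X, T, Y\<close> to \<open>a A X, A T, A Y / a\<close> and
  the curvature \<open>k\<close> to \<open>k / a\<^sup>2\<close>. The flow equation for \<open>f M X\<close> therefore reads
  \<open>f' / f + \<langle>M\<^sup>-\<^sup>1 M' X, Y\<rangle> = - f\<^sup>2 / k\<close>. Every element of the Lie algebra of \<open>O\<^sub>1(3)\<close> is a
  Lorentzian cross product with some \<open>w\<close>, and \<open>\<langle>w \<times> X, Y\<rangle> = \<mp> \<langle>T, w\<rangle>\<close> with a sign that is
  constant along the curve. At \<open>t = 0\<close> this gives the equation for \<open>1 / k\<close>; if \<open>M'(0) = 0\<close>, then
  \<open>k\<close> is constant and \<open>v = Y + k X\<close> is constant and orthogonal to \<open>T\<close>. Conversely the equation is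
  solved by \<open>f' = - c f\<^sup>3\<close> and \<open>M = exp (\<phi> B)\<close> with \<open>\<phi>' = f\<^sup>2\<close> and \<open>B\<close> a cross product; the
  exponential is explicit because \<open>B\<^sup>3\<close> is a multiple of \<open>B\<close>.
\<close>

subsection \<open>Smooth functions\<close>

text \<open>Each summand of the product rule keeps one factor undifferentiated; this lowers that
  factor to the order at which the induction in \<open>Ck_on_bilinear\<close> works.\<close>

lemma Ck_on_Suc_imp: "Ck_on (Suc k) S f \<Longrightarrow> Ck_on k S f"
proof (induction k arbitrary: f)
  case 0
  then show ?case
    by (auto intro: has_derivative_continuous_on)
next
  case (Suc k)
  then show ?case
    by (metis Ck_on.simps(2))
qed

text \<open>Derivatives within \<open>S\<close> at points of \<open>S\<close> see only the values on
  \<open>S\<close>.\<close>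

lemma Ck_on_cong:
  assumes "\<And>x. x \<in> S \<Longrightarrow> f x = g x"
  shows "Ck_on k S f \<longleftrightarrow> Ck_on k S g"
proof (cases k)
  case 0
  then show ?thesis
    using assms by (simp cong: continuous_on_cong)
next
  case (Suc n)
  have "(f has_derivative D) (at x within S) \<longleftrightarrow> (g has_derivative D) (at x within S)"
    if "x \<in> S" for x D
    using has_derivative_transform[of x S f g D] has_derivative_transform[of x S g f D] assms that
    by auto
  then show ?thesis
    by (simp add: Suc cong: ball_cong)
qed

lemma Ck_on_const: "Ck_on k S (\<lambda>x. c)"
proof (induction k arbitrary: c)
  case (Suc k)
  then show ?case
    by (auto intro!: exI[of _ "\<lambda>x v. 0"])
qed auto

lemma Ck_on_add:
  "Ck_on k S f \<Longrightarrow> Ck_on k S g \<Longrightarrow> Ck_on k S (\<lambda>x. f x + g x)"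
proof (induction k arbitrary: f g)
  case 0
  then show ?case by (auto intro: continuous_intros)
next
  case (Suc k)
  from Suc.prems obtain f' g' where
    "\<forall>x\<in>S. (f has_derivative f' x) (at x within S)" "\<forall>v. Ck_on k S (\<lambda>x. f' x v)"
    "\<forall>x\<in>S. (g has_derivative g' x) (at x within S)" "\<forall>v. Ck_on k S (\<lambda>x. g' x v)"
    by auto
  then show ?case
    using Suc.IH by (auto intro!: exI[of _ "\<lambda>x v. f' x v + g' x v"] has_derivative_add)
qed

text \<open>By the product rule the derivative in a fixed direction is a sum of two values of the
  same \<open>p\<close>, so the induction closes. One proof serves both products and scalar
  multiples.\<close>

lemma Ck_on_bilinear:
  assumes "bounded_bilinear p"
  shows "Ck_on k S f \<Longrightarrow> Ck_on k S g \<Longrightarrow> Ck_on k S (\<lambda>x. p (f x) (g x))"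
proof (induction k arbitrary: f g)
  case 0
  then show ?case
    using bounded_bilinear.continuous_on[OF assms] by auto
next
  case (Suc k)
  from Suc.prems obtain f' g' where
    d: "\<forall>x\<in>S. (f has_derivative f' x) (at x within S)" "\<forall>v. Ck_on k S (\<lambda>x. f' x v)"
    "\<forall>x\<in>S. (g has_derivative g' x) (at x within S)" "\<forall>v. Ck_on k S (\<lambda>x. g' x v)"
    by auto
  have "Ck_on k S (\<lambda>x. p (f x) (g' x v) + p (f' x v) (g x))" for v
    using d Ck_on_Suc_imp[OF Suc.prems(1)] Ck_on_Suc_imp[OF Suc.prems(2)]
    by (intro Ck_on_add Suc.IH) blast+
  then show ?case
    using d by (auto intro!: exI[of _ "\<lambda>x v. p (f x) (g' x v) + p (f' x v) (g x)"]
        bounded_bilinear.FDERIV[OF assms])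
qed

text \<open>For a linear inner map the chain rule turns the direction \<open>v\<close> into
  \<open>L v\<close>, which does not depend on the point; the hypothesis on fixed directions
  therefore suffices. It is applied to the two projections of a product.\<close>

lemma Ck_on_compose_linear:
  assumes "bounded_linear L" and "L ` S' \<subseteq> S"
  shows "Ck_on k S f \<Longrightarrow> Ck_on k S' (\<lambda>x. f (L x))"
proof (induction k arbitrary: f)
  case 0
  then show ?case
    using assms
    by (auto intro: continuous_on_compose2 linear_continuous_on)
next
  case (Suc k)
  from Suc.prems obtain f' where
    d: "\<forall>x\<in>S. (f has_derivative f' x) (at x within S)" "\<forall>v. Ck_on k S (\<lambda>x. f' x v)"
    by auto
  have "((\<lambda>x. f (L x)) has_derivative (\<lambda>v. f' (L x) (L v))) (at x within S')" if "x \<in> S'" for x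
  proof (rule has_derivative_in_compose[OF bounded_linear_imp_has_derivative[OF assms(1)]])
    show "(f has_derivative f' (L x)) (at (L x) within L ` S')"
      using d(1) that assms(2) by (blast intro: has_derivative_subset)
  qed
  then show ?case
    using d Suc.IH by (auto intro!: exI[of _ "\<lambda>x v. f' (L x) (L v)"])
qed

lemma Ck_on_SucI:
  fixes f :: "real \<Rightarrow> 'b::real_normed_vector"
  assumes "\<And>x. x \<in> S \<Longrightarrow> (f has_vector_derivative f' x) (at x within S)"
    and "Ck_on k S f'"
  shows "Ck_on (Suc k) S f"
proof -
  have "Ck_on k S (\<lambda>x. v *\<^sub>R f' x)" for v
    by (intro Ck_on_bilinear[OF bounded_bilinear_scaleR] Ck_on_const assms)
  then show ?thesis
    using assms(1)
    by (auto simp: has_vector_derivative_def intro!: exI[of _ "\<lambda>x v. v *\<^sub>R f' x"])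
qed

lemmas Ck_on_scaleR = Ck_on_bilinear[OF bounded_bilinear_scaleR]
lemmas Ck_on_mult = Ck_on_bilinear[OF bounded_bilinear_mult]

lemma Ck_on_linear:
  assumes "bounded_linear L" and "Ck_on k S f"
  shows "Ck_on k S (\<lambda>x. L (f x))"
proof -
  \<comment> \<open>A linear map becomes a bilinear one with first argument frozen at 1, which
    replaces a separate induction.\<close>
  have "bounded_bilinear (\<lambda>(r::real) x. r *\<^sub>R L x)"
    by (intro bounded_bilinear.comp[OF bounded_bilinear_scaleR] assms(1) bounded_linear_ident)
  from Ck_on_bilinear[OF this Ck_on_const assms(2), of 1] show ?thesis by simp
qed

section \<open>Uniqueness of derivatives within an interval\<close>

lemma connected_at_within_neq_bot:
  fixes x :: real
  assumes "connected S" "x \<in> S" "a \<in> S" "b \<in> S" "a \<noteq> b"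
  shows "at x within S \<noteq> bot"
proof -
  have "S \<noteq> {z}" for z using assms by blast
  then show ?thesis
    using connected_imp_perfect[OF assms(1,2)] by (simp add: trivial_limit_within)
qed

lemma nondegenerate_two_points:
  assumes "nondegenerate_interval I"
  obtains a b where "a \<in> I" "b \<in> I" "a \<noteq> b"
proof -
  from assms obtain x where x: "x \<in> interior I"
    by (auto simp: nondegenerate_interval_def)
  then obtain e where "e > 0" "cball x e \<subseteq> I"
    by (auto simp: mem_interior_cball)
  then have "x \<in> I" "x + e \<in> I"
    by (auto simp: dist_real_def)
  with \<open>e > 0\<close> show ?thesis using that[of x "x + e"] by auto
qed

lemma nondegenerate_at_within_neq_bot:
  assumes "nondegenerate_interval I" "x \<in> I"
  shows "at x within I \<noteq> bot"
  using assms nondegenerate_two_points connected_at_within_neq_bot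
  by (metis nondegenerate_interval_def is_interval_connected)

lemma smooth_on_real_deriv:
  fixes f :: "real \<Rightarrow> 'b::real_normed_vector"
  assumes "nondegenerate_interval I" "smooth_on I f"
  shows "\<And>s. s \<in> I \<Longrightarrow> (f has_vector_derivative vector_derivative f (at s within I)) (at s within I)"
    and "smooth_on I (\<lambda>s. vector_derivative f (at s within I))"
proof -
  \<comment> \<open>The witness \<open>f'\<close> may depend on the order \<open>k\<close>.
    Uniqueness of derivatives within \<open>I\<close> later identifies all of these witnesses with
    \<open>vector_derivative\<close>.\<close>
  have ex: "\<exists>f'. (\<forall>s\<in>I. (f has_vector_derivative f' s) (at s within I)) \<and> Ck_on k I f'" for k
  proof -
    from assms(2) have "Ck_on (Suc k) I f" by (simp add: smooth_on_def)
    then obtain f' where f': "\<forall>s\<in>I. (f has_derivative f' s) (at s within I)"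
        "\<forall>v. Ck_on k I (\<lambda>s. f' s v)"
      by auto
    moreover have "f' s = (\<lambda>h. h *\<^sub>R f' s 1)" if "s \<in> I" for s
    proof
      have "bounded_linear (f' s)"
        using f'(1) that has_derivative_bounded_linear by blast
      then show "f' s h = h *\<^sub>R f' s 1" for h
        using linear_simps(5)[of "f' s" h 1] by simp
    qed
    ultimately have "\<forall>s\<in>I. (f has_vector_derivative f' s 1) (at s within I)"
      using f'(1) by (auto simp: has_vector_derivative_def)
    with f'(2) show ?thesis by (intro exI[of _ "\<lambda>s. f' s 1"]) auto
  qed
  show *: "(f has_vector_derivative vector_derivative f (at s within I)) (at s within I)"
    if "s \<in> I" for s
    using ex[of 0] that by (metis vector_derivative_works differentiableI_vector)
  have "Ck_on k I (\<lambda>s. vector_derivative f (at s within I))" for k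
  proof -
    from ex[of k] obtain f' where f': "\<forall>s\<in>I. (f has_vector_derivative f' s) (at s within I)"
      and "Ck_on k I f'" by auto
    moreover have "vector_derivative f (at s within I) = f' s" if "s \<in> I" for s
      using f' that by (intro vector_derivative_within nondegenerate_at_within_neq_bot assms) auto
    ultimately show ?thesis
      by (subst Ck_on_cong[of I _ f']) auto
  qed
  then show "smooth_on I (\<lambda>s. vector_derivative f (at s within I))"
    by (simp add: smooth_on_def)
qed

subsection \<open>Null frames in Minkowski space\<close>

lemma bounded_bilinear_mink: "bounded_bilinear mink"
proof -
  have "bilinear mink"
    by (auto simp: bilinear_def mink_def algebra_simps intro!: linearI)
  then show ?thesis by (simp add: bilinear_conv_bounded_bilinear)
qed

lemmas mink_simps =
  bounded_bilinear.add_left[OF bounded_bilinear_mink]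
  bounded_bilinear.add_right[OF bounded_bilinear_mink]
  bounded_bilinear.diff_left[OF bounded_bilinear_mink]
  bounded_bilinear.diff_right[OF bounded_bilinear_mink]
  bounded_bilinear.scaleR_left[OF bounded_bilinear_mink]
  bounded_bilinear.scaleR_right[OF bounded_bilinear_mink]
  bounded_bilinear.zero_left[OF bounded_bilinear_mink]
  bounded_bilinear.zero_right[OF bounded_bilinear_mink]
  bounded_bilinear.minus_left[OF bounded_bilinear_mink]
  bounded_bilinear.minus_right[OF bounded_bilinear_mink]

lemma mink_commute: "mink u v = mink v u"
  by (simp add: mink_def)

lemma mink_nondegenerate:
  assumes "\<And>v. mink u v = 0"
  shows "u = 0"
  using assms[of "axis 1 1"] assms[of "axis 2 1"] assms[of "axis 3 1"]
  by (simp add: mink_def axis_def vec_eq_iff forall_3)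

text \<open>The product rule and the zero derivative of a constant must agree, because the filter is
  nontrivial. All differential relations of the frame come from constant scalar products in this
  way.\<close>

lemma mink_has_derivative_const:
  fixes g h :: "real \<Rightarrow> real^3"
  assumes "at s within I \<noteq> bot" "s \<in> I"
    and "(g has_vector_derivative g') (at s within I)"
    and "(h has_vector_derivative h') (at s within I)"
    and "\<And>u. u \<in> I \<Longrightarrow> mink (g u) (h u) = c"
  shows "mink (g s) h' + mink g' (h s) = 0"
proof -
  have "((\<lambda>u. mink (g u) (h u)) has_vector_derivative mink (g s) h' + mink g' (h s)) (at s within I)"
    by (rule bounded_bilinear.has_vector_derivative[OF bounded_bilinear_mink assms(3,4)])
  moreover have "((\<lambda>u. mink (g u) (h u)) has_vector_derivative 0) (at s within I)"
    by (rule has_vector_derivative_transform[OF assms(2) _ has_vector_derivative_const[of c]])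
      (use assms(5) in auto)
  ultimately show ?thesis
    using vector_derivative_within[OF assms(1)] by metis
qed

text \<open>Normalised so that \<open>mink (lcross u v) w\<close> is the determinant of \<open>u, v, w\<close>.\<close>

definition lcross :: "real^3 \<Rightarrow> real^3 \<Rightarrow> real^3" where
  "lcross u v = vector [u$3 * v$2 - u$2 * v$3, u$3 * v$1 - u$1 * v$3, u$1 * v$2 - u$2 * v$1]"

lemma lcross_nth [simp]:
  "lcross u v $ 1 = u$3 * v$2 - u$2 * v$3"
  "lcross u v $ 2 = u$3 * v$1 - u$1 * v$3"
  "lcross u v $ 3 = u$1 * v$2 - u$2 * v$1"
  by (simp_all add: lcross_def)

lemma bounded_linear_lcross_right: "bounded_linear (lcross w)"
  unfolding linear_conv_bounded_linear[symmetric]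
  by (rule linearI) (simp_all add: vec_eq_iff forall_3 algebra_simps)

lemma mink_lcross_rotate: "mink (lcross u v) w = mink (lcross v w) u"
  by (simp add: mink_def algebra_simps)

lemma mink_lcross_self [simp]:
  "mink (lcross u v) u = 0" "mink (lcross u v) v = 0"
  by (simp_all add: mink_def algebra_simps)

text \<open>This is membership of the cross product with \<open>w\<close> in the Lie algebra of the
  Lorentz group.\<close>

lemma mink_lcross_skew: "mink (lcross w u) v + mink u (lcross w v) = 0"
  by (simp add: mink_def algebra_simps)

text \<open>Cayley-Hamilton: the cross product with \<open>w\<close> has trace and determinant zero.
  The sign of \<open>mink w w\<close> tells hyperbolic, parabolic and elliptic generators
  apart.\<close>

lemma lcross_cube: "lcross w (lcross w (lcross w u)) = mink w w *\<^sub>R lcross w u"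
  by (simp add: vec_eq_iff forall_3 mink_def algebra_simps)

text \<open>The frame is stated for bare vectors, so that its algebra is independent of curves.
  Since \<open>mink x y = 1\<close> forces \<open>x\<close> and \<open>y\<close> to be nonzero, the
  null conditions place both in the light cone.\<close>

definition null_frame :: "real^3 \<Rightarrow> real^3 \<Rightarrow> real^3 \<Rightarrow> bool" where
  "null_frame x t y \<longleftrightarrow> mink x x = 0 \<and> mink t t = 1 \<and> mink y y = 0 \<and>
     mink x t = 0 \<and> mink y t = 0 \<and> mink x y = 1"

text \<open>The metric has determinant -1, so the squared determinant of three vectors is minus
  their Gram determinant, and the Gram determinant of a null frame is -1.\<close>

lemma null_frame_triple_square:
  assumes "null_frame x t y"
  shows "(mink (lcross x t) y)\<^sup>2 = 1"
proof -
  have "(mink (lcross x t) y)\<^sup>2 = - (mink x x * (mink t t * mink y y - (mink t y)\<^sup>2)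
     - mink x t * (mink x t * mink y y - mink t y * mink x y)
     + mink x y * (mink x t * mink t y - mink t t * mink x y))"
    by (simp add: mink_def power2_eq_square algebra_simps)
  then show ?thesis
    using assms by (simp add: null_frame_def mink_commute[of t y])
qed

text \<open>The null vectors \<open>x\<close> and \<open>y\<close> are dual to each other, so the
  coefficient along one is the scalar product with the other.\<close>

lemma null_frame_expand:
  assumes "null_frame x t y"
  shows "u = mink u y *\<^sub>R x + mink u x *\<^sub>R y + mink u t *\<^sub>R t"
proof -
  define w where "w = u - (mink u y *\<^sub>R x + mink u x *\<^sub>R y + mink u t *\<^sub>R t)"
  have o: "mink w x = 0" "mink w t = 0" "mink w y = 0"
    using assms by (auto simp: w_def mink_simps null_frame_def mink_commute)
  \<comment> \<open>Cramer's rule: \<open>w\<close> times the determinant of the frame is recovered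
    from its scalar products with the frame.\<close>
  have "mink (lcross x t) y *\<^sub>R w
      = mink w x *\<^sub>R lcross t y + mink w t *\<^sub>R lcross y x + mink w y *\<^sub>R lcross x t"
    by (simp add: vec_eq_iff forall_3 mink_def algebra_simps)
  then have "mink (lcross x t) y *\<^sub>R w = 0"
    using o by simp
  moreover have "mink (lcross x t) y \<noteq> 0"
    using null_frame_triple_square[OF assms] by auto
  ultimately show ?thesis by (simp add: w_def)
qed

text \<open>A null vector without time component has zero Euclidean length. Hence a continuous path
  in the cone cannot change the sign of its first coordinate.\<close>

lemma light_cone_nth1_nonzero:
  assumes "x \<in> light_cone"
  shows "x$1 \<noteq> 0"
proof
  assume "x$1 = 0"
  with assms have "(x$2)\<^sup>2 + (x$3)\<^sup>2 = 0" and "x \<noteq> 0"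
    by (auto simp: light_cone_def mink_def power2_eq_square)
  with \<open>x$1 = 0\<close> show False
    by (simp add: sum_power2_eq_zero_iff vec_eq_iff forall_3)
qed

lemma null_frame_exists:
  assumes "x \<in> light_cone" "mink t t = 1" "mink x t = 0"
  shows "\<exists>y. null_frame x t y"
proof -
  have q: "(x$1)\<^sup>2 = (x$2)\<^sup>2 + (x$3)\<^sup>2"
    using assms(1) by (auto simp: light_cone_def mink_def power2_eq_square)
  have x1: "x$1 \<noteq> 0"
    using light_cone_nth1_nonzero assms(1) by blast
  \<comment> \<open>The time reflection of \<open>x\<close> is null and has product
    \<open>2 * (x$1)\<^sup>2\<close> with \<open>x\<close>; the factor normalises this to 1.\<close>
  define z :: "real^3" where "z = (1 / (2 * (x$1)\<^sup>2)) *\<^sub>R vector [- x$1, x$2, x$3]"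
  have zz: "mink z z = 0"
    using assms(1) by (simp add: z_def mink_simps) (simp add: mink_def light_cone_def)
  have "mink x (vector [- x$1, x$2, x$3]) = 2 * (x$1)\<^sup>2"
    using q by (simp add: mink_def power2_eq_square)
  then have xz: "mink x z = 1"
    using x1 by (simp add: z_def mink_simps)
  define a where "a = mink z t"
  \<comment> \<open>Subtracting \<open>a *\<^sub>R t\<close> achieves orthogonality to
    \<open>t\<close> but leaves the norm \<open>- a\<^sup>2\<close>; the multiple of
    \<open>x\<close> repairs the norm and does not change the products with \<open>x\<close> and
    \<open>t\<close>.\<close>
  define y where "y = z - a *\<^sub>R t + (a\<^sup>2 / 2) *\<^sub>R x"
  have "null_frame x t y"
    using assms xz zz a_def mink_commute[of t z] mink_commute[of z x] mink_commute[of t x]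
    by (simp add: null_frame_def y_def mink_simps light_cone_def power2_eq_square)
  then show ?thesis by blast
qed

text \<open>Expanded in the first frame, \<open>y'\<close> is \<open>y\<close> plus a multiple of
  \<open>x\<close>; its norm is twice the coefficient, which must therefore vanish.\<close>

lemma null_frame_unique:
  assumes "null_frame x t y" "null_frame x t y'"
  shows "y' = y"
proof -
  have e: "y' = mink y' y *\<^sub>R x + y"
    using null_frame_expand[OF assms(1), of y'] assms(2) by (simp add: null_frame_def mink_commute)
  then have "mink y' y' = mink (mink y' y *\<^sub>R x + y) (mink y' y *\<^sub>R x + y)"
    by simp
  also have "\<dots> = 2 * mink y' y"
    using assms(1) by (simp add: mink_simps null_frame_def mink_commute)
  finally have "mink y' y = 0"
    using assms(2) by (simp add: null_frame_def)
  with e show ?thesis by simp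
qed

section \<open>The associated curve, the curvature and the Frenet equations\<close>

lemma associated_eqI:
  assumes "null_frame (X s) (unit_tangent I X s) y"
  shows "associated I X s = y"
  unfolding associated_def
proof (rule the_equality)
  have "y \<noteq> 0"
    using assms by (auto simp: null_frame_def mink_simps)
  then show "y \<in> light_cone \<and> mink y (unit_tangent I X s) = 0 \<and> mink (X s) y = 1"
    using assms by (auto simp: null_frame_def light_cone_def)
  fix y' assume "y' \<in> light_cone \<and> mink y' (unit_tangent I X s) = 0 \<and> mink (X s) y' = 1"
  with assms have "null_frame (X s) (unit_tangent I X s) y'"
    by (auto simp: null_frame_def light_cone_def)
  then show "y' = y" using null_frame_unique assms by blast
qed

lemma curvature_eqI:
  assumes "X s \<noteq> 0"
    and "vector_derivative (unit_tangent I X) (at s within I) = \<kappa> *\<^sub>R X s - associated I X s"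
  shows "curvature I X s = \<kappa>"
  unfolding curvature_def using assms by (intro the_equality) auto

text \<open>Differentiating the constant products of \<open>X\<close> and \<open>T\<close> shows
  that \<open>T'\<close> has product -1 with \<open>X\<close> and 0 with \<open>T\<close>. In the
  null frame only the coefficient along \<open>X\<close> is left open, and that is the
  curvature.\<close>

lemma arc_length_curve_frenet:
  assumes "arc_length_curve I X" "s \<in> I"
  shows "(X has_vector_derivative unit_tangent I X s) (at s within I)" (is ?d)
    and "null_frame (X s) (unit_tangent I X s) (associated I X s)" (is ?f)
    and "(unit_tangent I X has_vector_derivative curvature I X s *\<^sub>R X s - associated I X s)
           (at s within I)" (is ?k)
proof -
  let ?T = "unit_tangent I X"
  have T: "?T = (\<lambda>s. vector_derivative X (at s within I))"
    by (simp add: unit_tangent_def velocity_def fun_eq_iff)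
  have nd: "nondegenerate_interval I" and sm: "smooth_on I X"
    and cone: "\<And>u. u \<in> I \<Longrightarrow> X u \<in> light_cone"
    and unit: "\<And>u. u \<in> I \<Longrightarrow> mink (?T u) (?T u) = 1"
    using assms(1) by (auto simp: arc_length_curve_def spacelike_curve_def unit_tangent_def)
  note nb = nondegenerate_at_within_neq_bot[OF nd]
  have dX: "(X has_vector_derivative ?T u) (at u within I)" if "u \<in> I" for u
    unfolding T by (rule smooth_on_real_deriv(1)[OF nd sm that])
  have smT: "smooth_on I ?T"
    unfolding T by (rule smooth_on_real_deriv(2)[OF nd sm])
  have XT: "mink (X u) (?T u) = 0" if "u \<in> I" for u
    using mink_has_derivative_const[OF nb[OF that] that dX[OF that] dX[OF that], of 0] cone
    by (simp add: mink_commute light_cone_def)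
  define T' where "T' = vector_derivative ?T (at s within I)"
  have dT: "(?T has_vector_derivative T') (at s within I)"
    unfolding T'_def by (rule smooth_on_real_deriv(1)[OF nd smT assms(2)])
  have TT': "mink T' (?T s) = 0"
    using mink_has_derivative_const[OF nb[OF assms(2)] assms(2) dT dT unit]
    by (simp add: mink_commute)
  have XT': "mink T' (X s) = -1"
    using mink_has_derivative_const[OF nb[OF assms(2)] assms(2) dX[OF assms(2)] dT XT] unit[OF assms(2)]
    by (simp add: mink_commute)
  obtain y where y: "null_frame (X s) (?T s) y"
    using null_frame_exists cone unit XT assms(2) by blast
  then have ay: "associated I X s = y" by (rule associated_eqI)
  show ?d using dX assms(2) by blast
  show ?f using y ay by simp
  have "T' = mink T' y *\<^sub>R X s - associated I X s"
    using null_frame_expand[OF y, of T'] TT' XT' ay by simp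
  moreover from this have "curvature I X s = mink T' y"
    using cone[OF assms(2)] by (intro curvature_eqI) (auto simp: T'_def light_cone_def)
  ultimately show ?k using dT by simp
qed

subsection \<open>Homotheties\<close>

text \<open>This is the chain rule for the inverse of the affine map that \<open>l\<close> equals on
  \<open>I\<close>. It serves to pass to arc length on a curve of constant speed
  \<open>a\<close>.\<close>

lemma has_vector_derivative_affine_reparam:
  assumes "a > 0" and l: "\<And>v. v \<in> I \<Longrightarrow> l v = a * v + c"
    and F: "\<And>v. v \<in> I \<Longrightarrow> F (l v) = G v"
    and "u \<in> I" "(G has_vector_derivative G') (at u within I)"
  shows "(F has_vector_derivative (1 / a) *\<^sub>R G') (at (l u) within l ` I)"
proof -
  define h where "h w = (w - c) / a" for w
  have h: "h (l v) = v" if "v \<in> I" for v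
    using l that \<open>a > 0\<close> by (simp add: h_def)
  have "h ` l ` I = I"
    using h by (force simp: image_image)
  moreover have "(h has_vector_derivative 1 / a) (at (l u) within l ` I)"
    unfolding h_def has_real_derivative_iff_has_vector_derivative[symmetric]
    using \<open>a > 0\<close> by (auto intro!: derivative_eq_intros)
  ultimately have "((G \<circ> h) has_vector_derivative (1 / a) *\<^sub>R G') (at (l u) within l ` I)"
    using assms(4,5) h by (intro vector_diff_chain_within) auto
  then show ?thesis
    using assms(4) h F by (elim has_vector_derivative_transform[rotated 2]) auto
qed

text \<open>The function \<open>a * u\<close> has the required derivative, so the choice made by
  \<open>SOME\<close> has it too, and two such functions differ by a constant on the convex set
  \<open>I\<close>.\<close>

lemma arc_length_constant_speed:
  assumes "nondegenerate_interval I" "a > 0"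
    and "\<And>u. u \<in> I \<Longrightarrow> mink (velocity I Z u) (velocity I Z u) = a\<^sup>2"
  obtains c where "\<And>u. u \<in> I \<Longrightarrow> arc_length I Z u = a * u + c"
proof -
  let ?P = "\<lambda>l. \<forall>u\<in>I. (l has_real_derivative sqrt (mink (velocity I Z u) (velocity I Z u)))
                        (at u within I)"
  have "?P (\<lambda>u. a * u)"
    using assms by (auto intro!: derivative_eq_intros)
  then have "?P (arc_length I Z)"
    unfolding arc_length_def by (rule someI[of ?P])
  then have "(arc_length I Z has_real_derivative a) (at u within I)" if "u \<in> I" for u
    using that assms by simp
  then have "((\<lambda>u. arc_length I Z u - a * u) has_real_derivative 0) (at u within I)" if "u \<in> I" for u
    using that by (auto intro!: derivative_eq_intros)
  moreover have "convex I"
    using assms(1) by (simp add: nondegenerate_interval_def is_interval_convex)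
  ultimately obtain c where "\<And>u. u \<in> I \<Longrightarrow> arc_length I Z u - a * u = c"
    using has_field_derivative_zero_constant[of I "\<lambda>u. arc_length I Z u - a * u"] by blast
  then have "arc_length I Z u = a * u + c" if "u \<in> I" for u
    using that by force
  then show ?thesis using that by blast
qed

lemma bounded_linear_homothety: "bounded_linear (\<lambda>x. a *\<^sub>R ((A::real^'n^'m) *v x))"
  by (intro bounded_linear_const_scaleR matrix_vector_mul_bounded_linear)

lemma arc_length_curve_homothety_derivative:
  assumes "arc_length_curve I X" "s \<in> I"
  shows "((\<lambda>s. a *\<^sub>R (A *v X s)) has_vector_derivative a *\<^sub>R (A *v unit_tangent I X s)) (at s within I)"
  by (rule bounded_linear.has_vector_derivative[OF bounded_linear_homothety
        arc_length_curve_frenet(1)[OF assms]])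

lemma arc_length_curve_homothety_velocity:
  assumes "arc_length_curve I X" "s \<in> I"
  shows "velocity I (\<lambda>s. a *\<^sub>R (A *v X s)) s = a *\<^sub>R (A *v unit_tangent I X s)"
  unfolding velocity_def using assms
  by (intro vector_derivative_within nondegenerate_at_within_neq_bot
      arc_length_curve_homothety_derivative)
    (auto simp: arc_length_curve_def spacelike_curve_def)

text \<open>The image curve has constant speed \<open>a\<close>, so its arc length is affine and its
  unit tangent is \<open>A *v T\<close>. One more derivative in arc length contributes the factor
  \<open>1 / a\<close>; rewriting the result in the image frame turns \<open>k\<close> into
  \<open>k / a\<^sup>2\<close>.\<close>

lemma homothety_associated_curvature:
  assumes X: "arc_length_curve I X" and "a > 0" "A \<in> lorentz_group" and u: "u \<in> I"
  shows "associated_gen I (\<lambda>s. a *\<^sub>R (A *v X s)) u = (1 / a) *\<^sub>R (A *v associated I X u)"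
    and "curvature_gen I (\<lambda>s. a *\<^sub>R (A *v X s)) u = curvature I X u / a\<^sup>2"
proof -
  let ?T = "unit_tangent I X"
  define Z where "Z = (\<lambda>s. a *\<^sub>R (A *v X s))"
  define l where "l = arc_length I Z"
  define R where "R = arc_length_reparam I Z"
  define D where "D = l ` I"
  note frenet = arc_length_curve_frenet[OF X]
  have nd: "nondegenerate_interval I"
    using X by (simp add: arc_length_curve_def spacelike_curve_def)
  have A: "mink (A *v p) (A *v q) = mink p q" for p q
    using \<open>A \<in> lorentz_group\<close> by (simp add: lorentz_group_def)
  have "mink (velocity I Z v) (velocity I Z v) = a\<^sup>2" if "v \<in> I" for v
    using frenet(2)[OF that] that
    by (simp add: Z_def arc_length_curve_homothety_velocity[OF X] mink_simps A null_frame_def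
        power2_eq_square)
  then obtain c where l: "\<And>v. v \<in> I \<Longrightarrow> l v = a * v + c"
    using arc_length_constant_speed[OF nd \<open>a > 0\<close>] unfolding l_def by metis
  have inj: "inj_on l I"
    using l \<open>a > 0\<close> by (auto simp: inj_on_def)
  have R: "R (l v) = Z v" if "v \<in> I" for v
    using that inj by (simp add: R_def arc_length_reparam_def l_def)
  \<comment> \<open>The new parameter domain is a connected set with two points, so derivatives
    within it are unique.\<close>
  have bot: "at (l v) within D \<noteq> bot" if "v \<in> I" for v
  proof -
    have "continuous_on I l \<longleftrightarrow> continuous_on I (\<lambda>v. a * v + c)"
      using l by (intro continuous_on_cong) auto
    moreover have "continuous_on I (\<lambda>v. a * v + c)"
      by (intro continuous_intros)
    ultimately have "connected D"
      unfolding D_def using nd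
      by (auto simp: nondegenerate_interval_def is_interval_connected intro: connected_continuous_image)
    moreover obtain x y where "x \<in> I" "y \<in> I" "x \<noteq> y"
      using nd by (rule nondegenerate_two_points)
    ultimately show ?thesis
      using that inj by (intro connected_at_within_neq_bot[of D _ "l x" "l y"])
        (auto simp: D_def inj_on_def)
  qed
  have RT: "unit_tangent D R (l v) = A *v ?T v" if "v \<in> I" for v
  proof -
    have "(R has_vector_derivative (1 / a) *\<^sub>R (a *\<^sub>R (A *v ?T v))) (at (l v) within l ` I)"
      by (rule has_vector_derivative_affine_reparam[where F = R and G = Z, OF \<open>a > 0\<close> l R that])
        (simp_all add: Z_def arc_length_curve_homothety_derivative[OF X that])
    then show ?thesis
      using vector_derivative_within[OF bot[OF that]] \<open>a > 0\<close>
      by (simp add: unit_tangent_def velocity_def D_def)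
  qed
  have frame: "null_frame (R (l u)) (unit_tangent D R (l u)) ((1 / a) *\<^sub>R (A *v associated I X u))"
    using frenet(2)[OF u] \<open>a > 0\<close>
    by (simp add: R[OF u] RT[OF u] Z_def null_frame_def mink_simps A)
  have assoc: "associated D R (l u) = (1 / a) *\<^sub>R (A *v associated I X u)"
    by (rule associated_eqI[OF frame])
  have "(unit_tangent D R has_vector_derivative
      (1 / a) *\<^sub>R (A *v (curvature I X u *\<^sub>R X u - associated I X u))) (at (l u) within l ` I)"
    by (rule has_vector_derivative_affine_reparam[where F = "unit_tangent D R" and G = "\<lambda>v. A *v ?T v",
          OF \<open>a > 0\<close> l RT u])
      (auto intro!: bounded_linear.has_vector_derivative[OF matrix_vector_mul_bounded_linear]
        frenet(3)[OF u])
  then have "vector_derivative (unit_tangent D R) (at (l u) within D)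
      = (1 / a) *\<^sub>R (A *v (curvature I X u *\<^sub>R X u - associated I X u))"
    using vector_derivative_within[OF bot[OF u]] by (simp add: D_def)
  also have "\<dots> = (curvature I X u / a\<^sup>2) *\<^sub>R R (l u) - associated D R (l u)"
    using \<open>a > 0\<close>
    by (simp add: assoc R[OF u] Z_def matrix_vector_mult_diff_distrib matrix_vector_mult_scaleR
        scaleR_diff_right power2_eq_square)
  finally have "curvature D R (l u) = curvature I X u / a\<^sup>2"
    using frame by (intro curvature_eqI) (auto simp: null_frame_def mink_simps)
  then show "curvature_gen I (\<lambda>s. a *\<^sub>R (A *v X s)) u = curvature I X u / a\<^sup>2"
    by (simp add: curvature_gen_def arc_length_domain_def R_def D_def l_def Z_def)
  show "associated_gen I (\<lambda>s. a *\<^sub>R (A *v X s)) u = (1 / a) *\<^sub>R (A *v associated I X u)"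
    using assoc by (simp add: associated_gen_def arc_length_domain_def R_def D_def l_def Z_def)
qed

subsection \<open>From the flow to the tangent equation\<close>

text \<open>The cross product of \<open>x\<close> and \<open>y\<close> is orthogonal to both, hence
  a multiple of \<open>t\<close>, with coefficient \<open>- d\<close>. Rotating the triple product
  then isolates \<open>w\<close>.\<close>

lemma null_frame_mink_lcross:
  assumes "null_frame x t y" "lcross x t = d *\<^sub>R x"
  shows "mink (lcross w x) y = - d * mink t w"
proof -
  have "mink (lcross x y) t = - mink (lcross x t) y"
    by (simp add: mink_def algebra_simps)
  also have "\<dots> = - d"
    using assms by (simp add: mink_simps null_frame_def)
  finally have "lcross x y = - d *\<^sub>R t"
    using null_frame_expand[OF assms(1), of "lcross x y"] by simp
  then show ?thesis
    by (simp add: mink_lcross_rotate[of w] mink_simps)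
qed

text \<open>The cross product of \<open>X\<close> and \<open>T\<close> is orthogonal to both, hence
  a multiple of \<open>X\<close>. The factor is the determinant of the frame, which is 1 or -1 and
  constant by connectedness.\<close>

lemma arc_length_curve_orientation:
  assumes X: "arc_length_curve I X"
  obtains d :: real where "d\<^sup>2 = 1" "\<And>s. s \<in> I \<Longrightarrow> lcross (X s) (unit_tangent I X s) = d *\<^sub>R X s"
proof -
  let ?T = "unit_tangent I X"
  note frenet = arc_length_curve_frenet[OF X]
  \<comment> \<open>As a quotient of first coordinates the factor is continuous because
    \<open>X\<close> and \<open>T\<close> are; continuity of the associated curve does not
    enter.\<close>
  define d where "d s = lcross (X s) (?T s) $ 1 / X s $ 1" for s
  have X1: "X s $ 1 \<noteq> 0" if "s \<in> I" for s
    using X that light_cone_nth1_nonzero by (auto simp: arc_length_curve_def spacelike_curve_def)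
  have L: "lcross (X s) (?T s) = mink (lcross (X s) (?T s)) (associated I X s) *\<^sub>R X s"
    if "s \<in> I" for s
    using null_frame_expand[OF frenet(2)[OF that], of "lcross (X s) (?T s)"] by simp
  have d: "d s = mink (lcross (X s) (?T s)) (associated I X s)" if "s \<in> I" for s
    using arg_cong[OF L[OF that], of "\<lambda>v. v $ 1"] X1[OF that]
    unfolding d_def by (simp add: field_simps)
  have sq: "(d s)\<^sup>2 = 1" if "s \<in> I" for s
    using null_frame_triple_square[OF frenet(2)[OF that]] d[OF that] by simp
  have "continuous_on I X"
    by (rule continuous_on_vector_derivative[OF frenet(1)])
  moreover have "continuous_on I ?T"
    by (rule continuous_on_vector_derivative[OF frenet(3)])
  ultimately have "continuous_on I d"
    unfolding d_def lcross_nth using X1 by (intro continuous_intros) auto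
  moreover have nd: "nondegenerate_interval I"
    using X by (simp add: arc_length_curve_def spacelike_curve_def)
  then have "connected I"
    by (simp add: nondegenerate_interval_def is_interval_connected)
  moreover have "d ` I \<subseteq> {-1, 1}"
    using sq by (auto simp: power2_eq_1_iff)
  then have "finite (d ` I)"
    by (rule finite_subset) simp
  ultimately obtain e where e: "\<And>s. s \<in> I \<Longrightarrow> d s = e"
    using continuous_finite_range_constant[of I d] by (auto simp: constant_on_def)
  obtain s where "s \<in> I"
    using nd by (rule nondegenerate_two_points)
  then have "e\<^sup>2 = 1"
    using sq e by metis
  moreover have "lcross (X s) (?T s) = e *\<^sub>R X s" if "s \<in> I" for s
    using L[OF that] d[OF that] e[OF that] by simp
  ultimately show ?thesis
    using that by blast
qed

text \<open>Testing on basis vectors leaves three free entries, two for boosts and one for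
  rotations; up to sign they are the coordinates of \<open>w\<close>.\<close>

lemma mink_skew_imp_lcross:
  fixes A :: "real^3^3"
  assumes "\<And>u v. mink (A *v u) v + mink u (A *v v) = 0"
  shows "\<exists>w. \<forall>u. A *v u = lcross w u"
proof
  let ?w = "vector [- A$2$3, - A$1$3, A$1$2] :: real^3"
  note ij = assms[of "axis i 1" "axis j 1" for i j]
  have "A$1$1 = 0" "A$2$2 = 0" "A$3$3 = 0" "A$2$1 = A$1$2" "A$3$1 = A$1$3" "A$3$2 = - A$2$3"
    using ij[of 1 1] ij[of 2 2] ij[of 3 3] ij[of 1 2] ij[of 1 3] ij[of 2 3]
    by (simp_all add: mink_def matrix_vector_mult_def sum_3 axis_def)
  then show "\<forall>u. A *v u = lcross ?w u"
    by (simp add: vec_eq_iff forall_3 matrix_vector_mult_def sum_3)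
qed

text \<open>It supplies a nonzero \<open>v\<close> when the infinitesimal isometry of the flow
  vanishes and the flow equation only says that \<open>1 / k\<close> is constant.\<close>

lemma constant_curvature_tangent_orthogonal:
  assumes X: "arc_length_curve I X" and k: "\<And>s. s \<in> I \<Longrightarrow> curvature I X s = \<kappa>"
  shows "\<exists>v. v \<noteq> 0 \<and> (\<forall>s\<in>I. mink (unit_tangent I X s) v = 0)"
proof -
  let ?T = "unit_tangent I X" and ?Y = "associated I X"
  note frenet = arc_length_curve_frenet[OF X]
  have nd: "nondegenerate_interval I" and sm: "smooth_on I X"
    using X by (auto simp: arc_length_curve_def spacelike_curve_def)
  note bot = nondegenerate_at_within_neq_bot[OF nd]
  have smT: "smooth_on I ?T"
    using smooth_on_real_deriv(2)[OF nd sm]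
    by (simp add: unit_tangent_def[abs_def] velocity_def[abs_def])
  define T1 where "T1 s = vector_derivative ?T (at s within I)" for s
  define T2 where "T2 s = vector_derivative T1 (at s within I)" for s
  have dT: "(?T has_vector_derivative T1 s) (at s within I)" if "s \<in> I" for s
    unfolding T1_def by (rule smooth_on_real_deriv(1)[OF nd smT that])
  have smT1: "smooth_on I T1"
    unfolding T1_def[abs_def] by (rule smooth_on_real_deriv(2)[OF nd smT])
  have dT1: "(T1 has_vector_derivative T2 s) (at s within I)" if "s \<in> I" for s
    unfolding T2_def by (rule smooth_on_real_deriv(1)[OF nd smT1 that])
  have T1: "T1 s = \<kappa> *\<^sub>R X s - ?Y s" if "s \<in> I" for s
    using vector_derivative_within[OF bot[OF that] frenet(3)[OF that]] k[OF that]
    by (simp add: T1_def)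
  have g: "mink (T1 s) (X s) = -1" "mink (T1 s) (?T s) = 0" "mink (T1 s) (T1 s) = - 2 * \<kappa>"
    if "s \<in> I" for s
    using frenet(2)[OF that] by (auto simp: T1[OF that] mink_simps null_frame_def mink_commute)
  \<comment> \<open>The constants in \<open>g\<close> are differentiated. The third one, constant
    because the curvature is, removes the component of \<open>T2\<close> along
    \<open>X\<close>.\<close>
  have T2: "T2 s = (2 * \<kappa>) *\<^sub>R ?T s" if "s \<in> I" for s
  proof -
    have "mink (T2 s) (X s) = 0"
      using mink_has_derivative_const[OF bot[OF that] that dT1[OF that] frenet(1)[OF that] g(1)]
        g(2)[OF that] by simp
    moreover have "mink (T2 s) (?T s) = 2 * \<kappa>"
      using mink_has_derivative_const[OF bot[OF that] that dT1[OF that] dT[OF that] g(2)]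
        g(3)[OF that] by simp
    moreover have "mink (T2 s) (T1 s) = 0"
      using mink_has_derivative_const[OF bot[OF that] that dT1[OF that] dT1[OF that] g(3)]
      by (simp add: mink_commute)
    ultimately show ?thesis
      using null_frame_expand[OF frenet(2)[OF that], of "T2 s"] T1[OF that]
      by (simp add: mink_simps)
  qed
  \<comment> \<open>This is \<open>Y + \<kappa> X\<close>, written through \<open>T1\<close> so that
    only curves with known derivatives occur.\<close>
  define V where "V s = (2 * \<kappa>) *\<^sub>R X s - T1 s" for s
  have "(V has_vector_derivative (2 * \<kappa>) *\<^sub>R ?T s - T2 s) (at s within I)" if "s \<in> I" for s
    unfolding V_def
    by (intro has_vector_derivative_diff dT1[OF that]
        bounded_linear.has_vector_derivative[OF bounded_linear_scaleR_right] frenet(1)[OF that])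
  then have "(V has_vector_derivative 0) (at s within I)" if "s \<in> I" for s
    using T2 that by force
  moreover have "convex I"
    using nd by (simp add: nondegenerate_interval_def is_interval_convex)
  ultimately obtain v where v: "\<And>s. s \<in> I \<Longrightarrow> V s = v"
    using has_vector_derivative_zero_constant[of I V] by blast
  obtain s where "s \<in> I"
    using nd by (rule nondegenerate_two_points)
  have "mink (X s) (V s) = 1"
    using frenet(2)[OF \<open>s \<in> I\<close>] g(1)[OF \<open>s \<in> I\<close>]
    by (simp add: V_def mink_simps null_frame_def mink_commute)
  then have "v \<noteq> 0"
    using v[OF \<open>s \<in> I\<close>] by (auto simp: mink_simps)
  moreover have "mink (?T s) v = 0" if "s \<in> I" for s
    using frenet(2)[OF that] g(2)[OF that] v[OF that, symmetric]
    by (simp add: V_def mink_simps null_frame_def mink_commute)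
  ultimately show ?thesis by blast
qed

lemma bounded_linear_matrix_vector_mult_left:
  fixes x :: "real^'n"
  shows "bounded_linear (\<lambda>A::real^'n^'m. A *v x)"
  unfolding linear_conv_bounded_linear[symmetric]
  by (rule linearI) (simp_all add: matrix_vector_mult_add_rdistrib scaleR_matrix_vector_assoc)

lemma homothetic_family_has_vector_derivative:
  fixes M :: "real \<Rightarrow> real^'n^'m"
  assumes "(f has_vector_derivative f') (at t within J)"
    and "((\<lambda>\<tau>. M \<tau> *v x) has_vector_derivative m') (at t within J)"
  shows "((\<lambda>\<tau>. f \<tau> *\<^sub>R (M \<tau> *v x)) has_vector_derivative f t *\<^sub>R m' + f' *\<^sub>R (M t *v x))
      (at t within J)"
  by (rule bounded_bilinear.has_vector_derivative[OF bounded_bilinear_scaleR assms])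

text \<open>At time 0 the homothety is the identity and the derivative of \<open>M\<close> is a
  cross product with some \<open>w\<close>. The flow equation becomes the claim with
  \<open>c = - f'\<close> and \<open>v = d *\<^sub>R w\<close>.\<close>

lemma self_similar_flow_imp_tangent_equation:
  assumes X: "arc_length_curve I X" and flow: "self_similar_flow I X J f M"
  shows "\<exists>v c. v \<noteq> 0 \<and> (\<forall>s\<in>I. c + mink (unit_tangent I X s) v = 1 / curvature I X s)"
proof -
  let ?T = "unit_tangent I X"
  note frenet = arc_length_curve_frenet[OF X]
  from flow have nd: "nondegenerate_interval J" and "0 \<in> J"
    and smf: "smooth_on J f" and smM: "smooth_on J M" and [simp]: "f 0 = 1" "M 0 = mat 1"
    and iso: "\<And>t. t \<in> J \<Longrightarrow> M t \<in> lorentz_group"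
    and icf: "\<And>s. s \<in> I \<Longrightarrow>
      mink (vector_derivative (\<lambda>\<tau>. f \<tau> *\<^sub>R (M \<tau> *v X s)) (at 0 within J))
        (associated_gen I (\<lambda>s. f 0 *\<^sub>R (M 0 *v X s)) s)
      = - 1 / curvature_gen I (\<lambda>s. f 0 *\<^sub>R (M 0 *v X s)) s"
    unfolding self_similar_flow_def icf_solution_def cone_isometries_def by blast+
  note bot = nondegenerate_at_within_neq_bot[OF nd \<open>0 \<in> J\<close>]
  define f' where "f' = vector_derivative f (at 0 within J)"
  define M' where "M' = vector_derivative M (at 0 within J)"
  have df: "(f has_vector_derivative f') (at 0 within J)"
    unfolding f'_def by (rule smooth_on_real_deriv(1)[OF nd smf \<open>0 \<in> J\<close>])
  have "(M has_vector_derivative M') (at 0 within J)"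
    unfolding M'_def by (rule smooth_on_real_deriv(1)[OF nd smM \<open>0 \<in> J\<close>])
  then have dM: "((\<lambda>t. M t *v x) has_vector_derivative M' *v x) (at 0 within J)" for x
    by (rule bounded_linear.has_vector_derivative[OF bounded_linear_matrix_vector_mult_left])
  have "mink (M' *v u) v + mink u (M' *v v) = 0" for u v
    using mink_has_derivative_const[OF bot \<open>0 \<in> J\<close> dM[of u] dM[of v], of "mink u v"] iso
    by (simp add: lorentz_group_def)
  then obtain w where w: "\<And>u. M' *v u = lcross w u"
    using mink_skew_imp_lcross by blast
  obtain d where d: "d\<^sup>2 = 1" "\<And>s. s \<in> I \<Longrightarrow> lcross (X s) (?T s) = d *\<^sub>R X s"
    using arc_length_curve_orientation[OF X] by blast
  have eq: "- f' + mink (?T s) (d *\<^sub>R w) = 1 / curvature I X s" if s: "s \<in> I" for s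
  proof -
    have "mink (M' *v X s + f' *\<^sub>R X s) (associated I X s) = - 1 / curvature I X s"
      using icf[OF s] homothety_associated_curvature[OF X, of "f 0" "M 0"] iso[OF \<open>0 \<in> J\<close>] s
        vector_derivative_within[OF bot homothetic_family_has_vector_derivative[OF df dM]]
      by simp
    then show ?thesis
      using null_frame_mink_lcross[OF frenet(2)[OF s] d(2)[OF s], of w] frenet(2)[OF s]
      by (simp add: w mink_simps null_frame_def)
  qed
  show ?thesis
  \<comment> \<open>A vanishing \<open>w\<close> would give \<open>v = 0\<close>; the curvature is
    then constant and another \<open>v\<close> is available.\<close>
  proof (cases "w = 0")
    case False
    then have "d *\<^sub>R w \<noteq> 0"
      using d(1) by auto
    then show ?thesis using eq by blast
  next
    case True
    then have k: "1 / curvature I X s = - f'" if "s \<in> I" for s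
      using eq[OF that] by (simp add: mink_simps)
    then have "curvature I X s = 1 / (- f')" if "s \<in> I" for s
      using that by (metis div_by_1 divide_divide_eq_right mult_1)
    from constant_curvature_tangent_orthogonal[OF X this] obtain v
      where "v \<noteq> 0" "\<forall>s\<in>I. mink (?T s) v = 0" by blast
    then show ?thesis
      using k by (intro exI[of _ v] exI[of _ "- f'"]) auto
  qed
qed

subsection \<open>From the tangent equation to the flow\<close>

text \<open>Nondegeneracy makes \<open>A\<close> bijective. A preimage \<open>q\<close> of a point
  \<open>p\<close> of the half cone is null, and it is not in the lower half, since otherwise
  \<open>- q\<close> would be sent to \<open>- p\<close>.\<close>

lemma cone_isometriesI:
  assumes "A \<in> lorentz_group" and maps: "\<And>p. p \<in> light_cone_plus \<Longrightarrow> A *v p \<in> light_cone_plus"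
  shows "A \<in> cone_isometries"
proof -
  have A: "mink (A *v u) (A *v v) = mink u v" for u v
    using assms(1) by (simp add: lorentz_group_def)
  have "p = 0" if "A *v p = 0" for p
    using A[of p] that by (intro mink_nondegenerate) (simp add: mink_simps)
  then have "inj ((*v) A)"
    by (simp add: linear_injective_0)
  then have "surj ((*v) A)"
    by (intro linear_injective_imp_surjective) auto
  have "p \<in> (*v) A ` light_cone_plus" if p: "p \<in> light_cone_plus" for p
  proof -
    obtain q where q: "p = A *v q"
      using \<open>surj ((*v) A)\<close> by blast
    have "q \<in> light_cone"
      using p A[of q q] by (auto simp: q light_cone_plus_def light_cone_def)
    moreover have "\<not> q$1 < 0"
    proof
      assume "q$1 < 0"
      with \<open>q \<in> light_cone\<close> have "- q \<in> light_cone_plus"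
        by (simp add: light_cone_plus_def light_cone_def mink_simps)
      then have "- p \<in> light_cone_plus"
        using maps[of "- q"] linear_simps(4)[OF matrix_vector_mul_bounded_linear, of A q]
        by (simp add: q)
      with p show False by (simp add: light_cone_plus_def)
    qed
    ultimately have "q \<in> light_cone_plus"
      using light_cone_nth1_nonzero[of q] by (auto simp: light_cone_plus_def)
    with q show ?thesis by blast
  qed
  then show ?thesis
    using assms by (auto simp: cone_isometries_def)
qed

section \<open>Scalar differential equations for the scale and the one-parameter group\<close>

text \<open>These are the coefficients of \<open>exp (t B) = 1 + a B + b B\<^sup>2\<close> when \<open>B\<^sup>3 = \<mu> B\<close>.\<close>

lemma exp_cubic_coefficients:
  fixes \<mu> :: real
  obtains a b where "a 0 = 0" "b 0 = 0"
    "\<And>t. (a has_real_derivative 1 + \<mu> * b t) (at t)"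
    "\<And>t. (b has_real_derivative a t) (at t)"
proof -
  \<comment> \<open>With zero initial data \<open>b'' = 1 + \<mu> b\<close> has polynomial,
    hyperbolic or trigonometric solutions according to the sign of \<open>\<mu>\<close>.\<close>
  consider "\<mu> = 0" | "\<mu> > 0" | "\<mu> < 0" by linarith
  then show ?thesis
  proof cases
    case 1
    show ?thesis
      by (rule that[of "\<lambda>t. t" "\<lambda>t. t\<^sup>2 / 2"])
        (auto simp: 1 intro!: derivative_eq_intros)
  next
    case 2
    define r where "r = sqrt \<mu>"
    have r: "r > 0" "\<mu> = r * r" using 2 by (simp_all add: r_def)
    show ?thesis
      by (rule that[of "\<lambda>t. sinh (r * t) / r" "\<lambda>t. (cosh (r * t) - 1) / (r * r)"])
        (use r in \<open>auto intro!: derivative_eq_intros\<close>)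
  next
    case 3
    define r where "r = sqrt (- \<mu>)"
    have r: "r > 0" "\<mu> = - (r * r)" using 3 by (simp_all add: r_def)
    show ?thesis
      by (rule that[of "\<lambda>t. sin (r * t) / r" "\<lambda>t. (1 - cos (r * t)) / (r * r)"])
        (use r in \<open>auto intro!: derivative_eq_intros\<close>)
  qed
qed

text \<open>The equation \<open>f' = - c f^3\<close> says that \<open>1 / f\<^sup>2\<close> has
  constant derivative \<open>2 * c\<close>; \<open>J\<close> is where the solution
  \<open>1 + 2 * c * t\<close> of this is positive.\<close>

lemma homothety_factor:
  fixes c :: real
  defines "J \<equiv> {t. 1 + 2 * c * t > 0}"
  obtains f \<phi> :: "real \<Rightarrow> real" where "f 0 = 1" "\<And>t. t \<in> J \<Longrightarrow> f t > 0" "\<phi> 0 = 0"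
    "\<And>t. t \<in> J \<Longrightarrow> (f has_real_derivative - c * f t ^ 3) (at t)"
    "\<And>t. t \<in> J \<Longrightarrow> (\<phi> has_real_derivative (f t)\<^sup>2) (at t)"
    "c = 0 \<Longrightarrow> f = (\<lambda>_. 1)"
proof -
  let ?f = "\<lambda>t. inverse (sqrt (1 + 2 * c * t))"
  have df: "(?f has_real_derivative - c * ?f t ^ 3) (at t)" if "t \<in> J" for t
  proof -
    have q: "0 < 1 + 2 * c * t" using that by (simp add: J_def)
    have "((\<lambda>t. 1 + 2 * c * t) has_real_derivative 2 * c) (at t)"
      by (auto intro!: derivative_eq_intros)
    from DERIV_inverse'[OF DERIV_chain2[OF DERIV_real_sqrt[OF q] this]] q
    have "(?f has_real_derivative - (?f t * (?f t / 2 * (2 * c)) * ?f t)) (at t)"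
      by simp
    then show ?thesis
      by (simp add: power3_eq_cube mult_ac)
  qed
  have pos: "?f t > 0" if "t \<in> J" for t
    using that by (auto simp: J_def)
  obtain \<phi> where "\<phi> 0 = 0"
    and d\<phi>: "\<And>t. t \<in> J \<Longrightarrow> (\<phi> has_real_derivative (?f t)\<^sup>2) (at t)"
  \<comment> \<open>The antiderivative of \<open>1 / (1 + 2 * c * t)\<close> is logarithmic unless
    \<open>c\<close> vanishes.\<close>
  proof (cases "c = 0")
    case True
    show ?thesis
      by (rule that[of "\<lambda>t. t"]) (auto simp: True intro!: derivative_eq_intros)
  next
    case False
    have "((\<lambda>t. ln (1 + 2 * c * t) / (2 * c)) has_real_derivative (?f t)\<^sup>2) (at t)" if "t \<in> J" for t
    proof -
      have pos: "0 < 1 + 2 * c * t" using that by (simp add: J_def)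
      then have "(?f t)\<^sup>2 = 1 / (1 + 2 * c * t)"
        by (simp add: power_divide inverse_eq_divide)
      with pos show ?thesis
        using False by (auto intro!: derivative_eq_intros)
    qed
    then show ?thesis
      by (intro that[of "\<lambda>t. ln (1 + 2 * c * t) / (2 * c)"]) auto
  qed
  show ?thesis
    by (rule that[of ?f \<phi>]) (use df pos \<open>\<phi> 0 = 0\<close> d\<phi> in auto)
qed

text \<open>Composing the exponential coefficients with \<open>\<phi>\<close> runs the one-parameter
  group at speed \<open>f\<^sup>2\<close>, matching the scaling of the curvature.\<close>

lemma flow_coefficients:
  fixes c \<mu> :: real
  defines "J \<equiv> {t. 1 + 2 * c * t > 0}"
  obtains f \<alpha> \<beta> :: "real \<Rightarrow> real" where
    "f 0 = 1" "\<alpha> 0 = 0" "\<beta> 0 = 0" "\<And>t. t \<in> J \<Longrightarrow> f t > 0" "c = 0 \<Longrightarrow> f = (\<lambda>_. 1)"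
    "\<And>t. t \<in> J \<Longrightarrow> (f has_real_derivative - c * f t ^ 3) (at t within J)"
    "\<And>t. t \<in> J \<Longrightarrow> (\<alpha> has_real_derivative (f t)\<^sup>2 * (1 + \<mu> * \<beta> t)) (at t within J)"
    "\<And>t. t \<in> J \<Longrightarrow> (\<beta> has_real_derivative (f t)\<^sup>2 * \<alpha> t) (at t within J)"
    "smooth_on J f" "smooth_on J \<alpha>" "smooth_on J \<beta>"
proof -
  obtain f \<phi> where f: "f 0 = 1" "\<And>t. t \<in> J \<Longrightarrow> f t > 0" "\<phi> 0 = 0"
    "\<And>t. t \<in> J \<Longrightarrow> (f has_real_derivative - c * f t ^ 3) (at t)"
    "\<And>t. t \<in> J \<Longrightarrow> (\<phi> has_real_derivative (f t)\<^sup>2) (at t)"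
    "c = 0 \<Longrightarrow> f = (\<lambda>_. 1)"
    using homothety_factor[of c] unfolding J_def by blast
  obtain a b where ab: "a 0 = 0" "b 0 = 0"
    "\<And>t. (a has_real_derivative 1 + \<mu> * b t) (at t)"
    "\<And>t. (b has_real_derivative a t) (at t)"
    using exp_cubic_coefficients[of \<mu>] by blast
  define \<alpha> \<beta> where "\<alpha> = (\<lambda>t. a (\<phi> t))" and "\<beta> = (\<lambda>t. b (\<phi> t))"
  have df: "(f has_real_derivative - c * f t ^ 3) (at t within J)" if "t \<in> J" for t
    using f(4)[OF that] by (rule has_field_derivative_at_within)
  have da: "(\<alpha> has_real_derivative (f t)\<^sup>2 * (1 + \<mu> * \<beta> t)) (at t within J)" if "t \<in> J" for t
    using DERIV_chain2[OF ab(3) f(5)[OF that]]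
    by (auto simp: \<alpha>_def \<beta>_def mult.commute intro: has_field_derivative_at_within)
  have db: "(\<beta> has_real_derivative (f t)\<^sup>2 * \<alpha> t) (at t within J)" if "t \<in> J" for t
    using DERIV_chain2[OF ab(4) f(5)[OF that]]
    by (auto simp: \<alpha>_def \<beta>_def mult.commute intro: has_field_derivative_at_within)
  note d = df da db
  note dv = d[unfolded has_real_derivative_iff_has_vector_derivative]
  \<comment> \<open>The three derivatives are polynomials in the three functions, so regularity has
    to be raised for all of them at once.\<close>
  have "Ck_on k J f \<and> Ck_on k J \<alpha> \<and> Ck_on k J \<beta>" for k
  proof (induction k)
    case 0
    show ?case
      using DERIV_continuous_on[OF df] DERIV_continuous_on[OF da] DERIV_continuous_on[OF db] by simp
  next
    case (Suc k)
    then have k: "Ck_on k J f" "Ck_on k J \<alpha>" "Ck_on k J \<beta>"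
      by auto
    note intros = Ck_on_mult Ck_on_add Ck_on_const k
    have "Ck_on k J (\<lambda>t. - c * (f t * (f t * f t)))"
      by (intro intros)
    moreover have "Ck_on k J (\<lambda>t. f t * (f t * (1 + \<mu> * \<beta> t)))"
      by (intro intros)
    moreover have "Ck_on k J (\<lambda>t. f t * (f t * \<alpha> t))"
      by (intro intros)
    ultimately have "Ck_on k J (\<lambda>t. - c * f t ^ 3)" "Ck_on k J (\<lambda>t. (f t)\<^sup>2 * (1 + \<mu> * \<beta> t))"
      "Ck_on k J (\<lambda>t. (f t)\<^sup>2 * \<alpha> t)"
      by (simp_all add: power2_eq_square power3_eq_cube mult.assoc)
    then show ?case
      by (intro conjI) (rule Ck_on_SucI[OF dv(1)] Ck_on_SucI[OF dv(2)] Ck_on_SucI[OF dv(3)]; assumption)+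
  qed
  then show ?thesis
    using that[of f \<alpha> \<beta>] f(1-3,6) ab(1,2) d by (auto simp: smooth_on_def \<alpha>_def \<beta>_def)
qed

lemma nondegenerate_interval_flow_domain:
  fixes c :: real
  shows "nondegenerate_interval {t. 1 + 2 * c * t > 0}"
proof -
  have "0 < 1 + 2 * c * x" if "1 + 2 * c * a > 0" "1 + 2 * c * b > 0" "a \<le> x" "x \<le> b" for a b x
  proof (cases "c \<ge> 0")
    case True
    then have "2 * c * a \<le> 2 * c * x" using that by (intro mult_left_mono) auto
    with that show ?thesis by simp
  next
    case False
    then have "2 * c * b \<le> 2 * c * x" using that by (intro mult_left_mono_neg) auto
    with that show ?thesis by simp
  qed
  then have "is_interval {t. 1 + 2 * c * t > 0}"
    unfolding is_interval_1 by blast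
  moreover have "open {t. 1 + 2 * c * t > 0}"
    by (intro open_Collect_less continuous_intros)
  then have "0 \<in> interior {t. 1 + 2 * c * t > 0}"
    by (simp add: interior_open)
  ultimately show ?thesis
    by (auto simp: nondegenerate_interval_def)
qed

section \<open>Lorentz transformations generated by a cross product\<close>

definition lcross_matrix :: "real^3 \<Rightarrow> real^3^3" where
  "lcross_matrix w = matrix (lcross w)"

lemma lcross_matrix_mult [simp]: "lcross_matrix w *v u = lcross w u"
  by (simp add: lcross_matrix_def bounded_linear.linear[OF bounded_linear_lcross_right])

text \<open>With the coefficients constructed above this is \<open>exp (\<phi> B)\<close> for
  \<open>B = lcross_matrix w\<close>. The coefficients stay free, and their differential equations
  are imposed only where they are needed.\<close>

definition lorentz_path :: "(real \<Rightarrow> real) \<Rightarrow> (real \<Rightarrow> real) \<Rightarrow> real^3 \<Rightarrow> real \<Rightarrow> real^3^3" where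
  "lorentz_path \<alpha> \<beta> w t =
     mat 1 + \<alpha> t *\<^sub>R lcross_matrix w + \<beta> t *\<^sub>R (lcross_matrix w ** lcross_matrix w)"

lemma lorentz_path_mult:
  "lorentz_path \<alpha> \<beta> w t *v u = u + \<alpha> t *\<^sub>R lcross w u + \<beta> t *\<^sub>R lcross w (lcross w u)"
  by (simp add: lorentz_path_def matrix_vector_mult_add_rdistrib scaleR_matrix_vector_assoc[symmetric]
      matrix_vector_mul_assoc[symmetric])

text \<open>A polynomial in the cross product with \<open>w\<close> commutes with that cross
  product.\<close>

lemma lcross_lorentz_path:
  "lcross w (lorentz_path \<alpha> \<beta> w t *v u) = lorentz_path \<alpha> \<beta> w t *v lcross w u"
  by (simp add: lorentz_path_mult linear_simps[OF bounded_linear_lcross_right])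

text \<open>On the right-hand side the third power of the cross product is reduced by
  \<open>lcross_cube\<close>; this accounts for the term
  \<open>mink w w * \<beta> t\<close>.\<close>

lemma lorentz_path_has_vector_derivative:
  assumes "(\<alpha> has_real_derivative g * (1 + mink w w * \<beta> t)) (at t within J)"
    and "(\<beta> has_real_derivative g * \<alpha> t) (at t within J)"
  shows "((\<lambda>t. lorentz_path \<alpha> \<beta> w t *v u) has_vector_derivative
      g *\<^sub>R (lorentz_path \<alpha> \<beta> w t *v lcross w u)) (at t within J)"
  unfolding lorentz_path_mult
  using assms
  by (auto intro!: derivative_eq_intros
      simp: has_real_derivative_iff_has_vector_derivative[symmetric] lcross_cube algebra_simps)

text \<open>The generator is skew and commutes with the path, so scalar products of images have
  derivative zero and keep their value at time 0, where the path is the identity.\<close>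

lemma lorentz_path_cone_isometry:
  assumes nd: "nondegenerate_interval J" and "0 \<in> J" "\<alpha> 0 = 0" "\<beta> 0 = 0" and t: "t \<in> J"
    and da: "\<And>t. t \<in> J \<Longrightarrow> (\<alpha> has_real_derivative g t * (1 + mink w w * \<beta> t)) (at t within J)"
    and db: "\<And>t. t \<in> J \<Longrightarrow> (\<beta> has_real_derivative g t * \<alpha> t) (at t within J)"
  shows "lorentz_path \<alpha> \<beta> w t \<in> cone_isometries"
proof -
  let ?M = "lorentz_path \<alpha> \<beta> w"
  have M0: "?M 0 *v u = u" for u
    using assms by (simp add: lorentz_path_mult)
  note d = lorentz_path_has_vector_derivative[OF da db]
  have M: "mink (?M t *v u) (?M t *v v) = mink u v" if "t \<in> J" for t u v
  proof -
    have "((\<lambda>t. mink (?M t *v u) (?M t *v v)) has_vector_derivative 0) (at t within J)"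
      if "t \<in> J" for t
    proof -
      have "mink (?M t *v u) (g t *\<^sub>R (?M t *v lcross w v))
          + mink (g t *\<^sub>R (?M t *v lcross w u)) (?M t *v v) = 0"
        using mink_lcross_skew[of w "?M t *v u" "?M t *v v"]
        by (simp add: mink_simps lcross_lorentz_path add.commute flip: distrib_left)
      then show ?thesis
        using bounded_bilinear.has_vector_derivative[OF bounded_bilinear_mink d[OF that that, of u]
            d[OF that that, of v]] by simp
    qed
    moreover have "convex J"
      using nd by (simp add: nondegenerate_interval_def is_interval_convex)
    ultimately obtain c where "\<And>t. t \<in> J \<Longrightarrow> mink (?M t *v u) (?M t *v v) = c"
      using has_vector_derivative_zero_constant[of J "\<lambda>t. mink (?M t *v u) (?M t *v v)"] by blast
    then show ?thesis
      using that \<open>0 \<in> J\<close> M0 by metis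
  qed
  have lorentz: "?M t \<in> lorentz_group"
    using M[OF t] by (simp add: lorentz_group_def)
  show ?thesis
  proof (rule cone_isometriesI[OF lorentz])
    fix p assume p: "p \<in> light_cone_plus"
    have cone: "?M \<tau> *v p \<in> light_cone" if "\<tau> \<in> J" for \<tau>
    proof -
      have "?M \<tau> *v p \<noteq> 0"
      proof
        assume "?M \<tau> *v p = 0"
        then have "p = 0"
          using M[OF that, of p] by (intro mink_nondegenerate) (simp add: mink_simps)
        with p show False by (simp add: light_cone_plus_def light_cone_def)
      qed
      then show ?thesis
        using M[OF that, of p p] p by (simp add: light_cone_plus_def light_cone_def)
    qed
    have "continuous_on J (\<lambda>\<tau>. ?M \<tau> *v p)"
      by (rule continuous_on_vector_derivative[OF d])
    then have "continuous_on J (\<lambda>\<tau>. (?M \<tau> *v p) $ 1)"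
      by (rule continuous_on_component)
    then have conn: "connected ((\<lambda>\<tau>. (?M \<tau> *v p) $ 1) ` J)"
      using nd by (intro connected_continuous_image)
        (auto simp: nondegenerate_interval_def is_interval_connected)
    \<comment> \<open>The first coordinate starts positive and varies continuously; a change of sign
      would make it vanish at a point of the cone.\<close>
    have "(?M t *v p) $ 1 > 0"
    proof (rule ccontr)
      assume "\<not> (?M t *v p) $ 1 > 0"
      moreover have "p $ 1 > 0"
        using p by (simp add: light_cone_plus_def)
      moreover have "(?M t *v p) $ 1 \<in> (\<lambda>\<tau>. (?M \<tau> *v p) $ 1) ` J"
        "p $ 1 \<in> (\<lambda>\<tau>. (?M \<tau> *v p) $ 1) ` J"
        using t \<open>0 \<in> J\<close> by (auto intro!: image_eqI[of _ _ 0] simp: M0)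
      ultimately have "0 \<in> (\<lambda>\<tau>. (?M \<tau> *v p) $ 1) ` J"
        using connected_contains_Icc[OF conn] by fastforce
      then show False
        using cone light_cone_nth1_nonzero by force
    qed
    with cone[OF t] show "?M t *v p \<in> light_cone_plus"
      by (simp add: light_cone_plus_def)
  qed
qed

section \<open>Regularity of the homothetic family\<close>

lemma smooth_lorentz_path:
  assumes "smooth_on J \<alpha>" "smooth_on J \<beta>"
  shows "smooth_on J (lorentz_path \<alpha> \<beta> w)"
  using assms unfolding smooth_on_def lorentz_path_def[abs_def]
  by (auto intro!: Ck_on_add Ck_on_const Ck_on_scaleR)

text \<open>Joint smoothness follows from the explicit form: sums, scalings and linear images of
  functions that each depend on one of the two variables.\<close>

lemma smooth_homothetic_family:
  assumes "smooth_on I X" "smooth_on J f" "smooth_on J \<alpha>" "smooth_on J \<beta>"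
  shows "smooth_on (I \<times> J) (\<lambda>(s, t). f t *\<^sub>R (lorentz_path \<alpha> \<beta> w t *v X s))"
  unfolding smooth_on_def
proof
  fix k
  have snd: "Ck_on k (I \<times> J) (\<lambda>p. h (snd p))" if "smooth_on J h" for h :: "real \<Rightarrow> real"
    using that by (intro Ck_on_compose_linear[OF bounded_linear_snd, of _ J]) (auto simp: smooth_on_def)
  have X: "Ck_on k (I \<times> J) (\<lambda>p. X (fst p))"
    using assms by (intro Ck_on_compose_linear[OF bounded_linear_fst, of _ I]) (auto simp: smooth_on_def)
  note B = Ck_on_linear[OF bounded_linear_lcross_right]
  have "Ck_on k (I \<times> J) (\<lambda>p. f (snd p) *\<^sub>R (X (fst p) + \<alpha> (snd p) *\<^sub>R lcross w (X (fst p))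
      + \<beta> (snd p) *\<^sub>R lcross w (lcross w (X (fst p)))))"
    by (intro Ck_on_scaleR Ck_on_add snd assms X B)
  then show "Ck_on k (I \<times> J) (\<lambda>(s, t). f t *\<^sub>R (lorentz_path \<alpha> \<beta> w t *v X s))"
    by (simp add: lorentz_path_mult case_prod_unfold)
qed

lemma spacelike_curve_homothety:
  assumes X: "arc_length_curve I X" and cone: "X ` I \<subseteq> light_cone_plus"
    and "a > 0" "A \<in> cone_isometries"
  shows "spacelike_curve I (\<lambda>s. a *\<^sub>R (A *v X s)) \<and> (\<lambda>s. a *\<^sub>R (A *v X s)) ` I \<subseteq> light_cone_plus"
proof -
  have A: "mink (A *v p) (A *v q) = mink p q" for p q
    using assms by (simp add: cone_isometries_def lorentz_group_def)
  have "A *v X s \<in> light_cone_plus" if "s \<in> I" for s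
    using that assms by (auto simp: cone_isometries_def)
  then have plus: "a *\<^sub>R (A *v X s) \<in> light_cone_plus" if "s \<in> I" for s
    using that \<open>a > 0\<close> by (simp add: light_cone_plus_def light_cone_def mink_simps)
  have "smooth_on I (\<lambda>s. a *\<^sub>R (A *v X s))"
    using X
    by (auto simp: arc_length_curve_def spacelike_curve_def smooth_on_def
        intro: Ck_on_linear[OF bounded_linear_homothety])
  moreover have "mink (velocity I (\<lambda>s. a *\<^sub>R (A *v X s)) s) (velocity I (\<lambda>s. a *\<^sub>R (A *v X s)) s) > 0"
    if "s \<in> I" for s
    using arc_length_curve_frenet(2)[OF X that] \<open>a > 0\<close>
    by (simp add: arc_length_curve_homothety_velocity[OF X that] mink_simps A null_frame_def)
  ultimately show ?thesis
    using plus X by (auto simp: spacelike_curve_def arc_length_curve_def light_cone_plus_def)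
qed

text \<open>Scaling and isometry evolve so that both contributions to the normal velocity carry the
  factor \<open>f\<^sup>2\<close>; they add up to
  \<open>- f\<^sup>2 (c + \<langle>T, v\<rangle>)\<close>, which is \<open>- f\<^sup>2 / k\<close>
  for all times in \<open>J\<close>.\<close>

lemma tangent_equation_imp_self_similar_flow:
  assumes X: "arc_length_curve I X" and cone: "X ` I \<subseteq> light_cone_plus"
    and k: "\<And>s. s \<in> I \<Longrightarrow> curvature I X s \<noteq> 0"
    and eq: "\<And>s. s \<in> I \<Longrightarrow> c + mink (unit_tangent I X s) v = 1 / curvature I X s"
  shows "\<exists>J f M. self_similar_flow I X J f M \<and> (c = 0 \<longrightarrow> (\<forall>t\<in>J. f t = 1))"
proof -
  let ?T = "unit_tangent I X"
  note frenet = arc_length_curve_frenet[OF X]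
  obtain d where d: "d\<^sup>2 = 1" "\<And>s. s \<in> I \<Longrightarrow> lcross (X s) (?T s) = d *\<^sub>R X s"
    using arc_length_curve_orientation[OF X] by blast
  \<comment> \<open>As \<open>d\<^sup>2 = 1\<close>, this factor cancels the orientation sign in the
    product of the cross product with \<open>Y\<close>.\<close>
  define w where "w = d *\<^sub>R v"
  define J where "J = {t. 1 + 2 * c * t > 0}"
  obtain f \<alpha> \<beta> :: "real \<Rightarrow> real" where
    init: "f 0 = 1" "\<alpha> 0 = 0" "\<beta> 0 = 0" and pos: "\<And>t. t \<in> J \<Longrightarrow> f t > 0"
    and soliton: "c = 0 \<Longrightarrow> f = (\<lambda>_. 1)"
    and df: "\<And>t. t \<in> J \<Longrightarrow> (f has_real_derivative - c * f t ^ 3) (at t within J)"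
    and da: "\<And>t. t \<in> J \<Longrightarrow>
      (\<alpha> has_real_derivative (f t)\<^sup>2 * (1 + mink w w * \<beta> t)) (at t within J)"
    and db: "\<And>t. t \<in> J \<Longrightarrow> (\<beta> has_real_derivative (f t)\<^sup>2 * \<alpha> t) (at t within J)"
    and smooth: "smooth_on J f" "smooth_on J \<alpha>" "smooth_on J \<beta>"
    using flow_coefficients[of c "mink w w"] unfolding J_def by blast
  define M where "M = lorentz_path \<alpha> \<beta> w"
  have nd: "nondegenerate_interval J" and "0 \<in> J"
    using nondegenerate_interval_flow_domain[of c] by (auto simp: J_def)
  have iso: "M t \<in> cone_isometries" if "t \<in> J" for t
    unfolding M_def by (rule lorentz_path_cone_isometry[OF nd \<open>0 \<in> J\<close> init(2,3) that da db])
  then have lorentz: "M t \<in> lorentz_group" if "t \<in> J" for t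
    using that by (simp add: cone_isometries_def)
  have "M 0 = mat 1"
    using init by (simp add: M_def lorentz_path_def)
  have flow: "mink (vector_derivative (\<lambda>\<tau>. f \<tau> *\<^sub>R (M \<tau> *v X s)) (at t within J))
      (associated_gen I (\<lambda>s. f t *\<^sub>R (M t *v X s)) s)
      = - 1 / curvature_gen I (\<lambda>s. f t *\<^sub>R (M t *v X s)) s" if t: "t \<in> J" and s: "s \<in> I" for t s
  proof -
    have Mt: "mink (M t *v p) (M t *v q) = mink p q" for p q
      using lorentz[OF t] by (simp add: lorentz_group_def)
    have "((\<lambda>\<tau>. f \<tau> *\<^sub>R (M \<tau> *v X s)) has_vector_derivative
        f t *\<^sub>R ((f t)\<^sup>2 *\<^sub>R (M t *v lcross w (X s))) + (- c * f t ^ 3) *\<^sub>R (M t *v X s)) (at t within J)"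
      unfolding M_def
      by (intro homothetic_family_has_vector_derivative lorentz_path_has_vector_derivative da db t
          df[OF t, unfolded has_real_derivative_iff_has_vector_derivative])
    note vd = vector_derivative_within[OF nondegenerate_at_within_neq_bot[OF nd t] this]
    have cross: "mink (lcross w (X s)) (associated I X s) = - mink (?T s) v"
      using null_frame_mink_lcross[OF frenet(2)[OF s] d(2)[OF s], of w] d(1)
      by (simp add: w_def mink_simps power2_eq_square flip: mult.assoc)
    have "mink (f t *\<^sub>R ((f t)\<^sup>2 *\<^sub>R (M t *v lcross w (X s))) + (- c * f t ^ 3) *\<^sub>R (M t *v X s))
        ((1 / f t) *\<^sub>R (M t *v associated I X s)) = - (f t)\<^sup>2 * (c + mink (?T s) v)"
      using pos[OF t] frenet(2)[OF s]
      by (simp add: mink_simps Mt cross null_frame_def power2_eq_square power3_eq_cube field_simps)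
    also have "\<dots> = - 1 / (curvature I X s / (f t)\<^sup>2)"
      by (simp add: eq[OF s])
    finally show ?thesis
      unfolding vd homothety_associated_curvature[OF X pos[OF t] lorentz[OF t] s] .
  qed
  have "icf_solution I J (\<lambda>t s. f t *\<^sub>R (M t *v X s)) X"
    unfolding icf_solution_def
  proof (intro conjI ballI)
    show "smooth_on (I \<times> J) (\<lambda>(s, t). f t *\<^sub>R (M t *v X s))"
      unfolding M_def using X
      by (intro smooth_homothetic_family smooth) (simp add: arc_length_curve_def spacelike_curve_def)
    fix t s assume t: "t \<in> J" and s: "s \<in> I"
    show "curvature_gen I (\<lambda>s. f t *\<^sub>R (M t *v X s)) s \<noteq> 0"
      using homothety_associated_curvature(2)[OF X pos[OF t] lorentz[OF t] s] k[OF s] pos[OF t]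
      by simp
  qed (use nd \<open>0 \<in> J\<close> flow spacelike_curve_homothety[OF X cone pos iso] init(1) \<open>M 0 = mat 1\<close>
      in auto)
  moreover have "smooth_on J M"
    unfolding M_def by (rule smooth_lorentz_path[OF smooth(2,3)])
  ultimately have "self_similar_flow I X J f M"
    using smooth(1) pos init(1) iso \<open>M 0 = mat 1\<close> by (simp add: self_similar_flow_def)
  then show ?thesis
    using soliton by auto
qed

theorem theorem1p6:
  fixes I :: "real set" and X :: "real \<Rightarrow> real^3"
  assumes "arc_length_curve I X"
    and "X ` I \<subseteq> light_cone_plus"
    and "\<forall>s\<in>I. curvature I X s \<noteq> 0"
  shows "(self_similar_solution I X \<longleftrightarrow>
            (\<exists>v c. v \<noteq> 0 \<and> (\<forall>s\<in>I. c + mink (unit_tangent I X s) v = 1 / curvature I X s)))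
       \<and> (\<forall>v c. v \<noteq> 0 \<and> (\<forall>s\<in>I. c + mink (unit_tangent I X s) v = 1 / curvature I X s) \<and> c = 0
            \<longrightarrow> soliton_solution I X)"
proof (intro conjI iffI allI impI)
  assume "self_similar_solution I X"
  then show "\<exists>v c. v \<noteq> 0 \<and> (\<forall>s\<in>I. c + mink (unit_tangent I X s) v = 1 / curvature I X s)"
    using self_similar_flow_imp_tangent_equation[OF assms(1)]
    by (auto simp: self_similar_solution_def)
next
  assume "\<exists>v c. v \<noteq> 0 \<and> (\<forall>s\<in>I. c + mink (unit_tangent I X s) v = 1 / curvature I X s)"
  then show "self_similar_solution I X"
    using tangent_equation_imp_self_similar_flow[OF assms(1,2)] assms(3)
    unfolding self_similar_solution_def by metis
next
  fix v c
  assume "v \<noteq> 0 \<and> (\<forall>s\<in>I. c + mink (unit_tangent I X s) v = 1 / curvature I X s) \<and> c = 0"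
  then show "soliton_solution I X"
    using tangent_equation_imp_self_similar_flow[OF assms(1,2), of c v] assms(3)
    unfolding soliton_solution_def by blast
qed

end
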